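(* Let $\Omega\subset\mathbb{R}^N$ be an open set, $q\in[1,\infty)$ and $u\in BV^q_{loc}(\Omega,\mathbb{R}^d)$. Then there exists an $\mathcal{H}^{N-1}$ $\sigma$-finite Borel set $S$ such that $$\liminf_{\varepsilon\to0^+}\fint_{B_\varepsilon(x)}\left|u(z)-u_{B_\varepsilon(x)}\right|^q\,dz=0\qquad\text{for } \mathcal{H}^{N-1}\text{-a.e. } x\in\Omega\setminus S .$$ That is, $\mathcal{S}''_u$ is an $\mathcal{H}^{N-1}$ $\sigma$-finite Borel set.
   Context: $N,d$ are natural numbers ($\geq 1$). $\mathcal{H}^{s}$ is $s$-dimensional Hausdorff measure; a set is $\mathcal{H}^{s}$ $\sigma$-finite if it is a countable union of sets of finite $\mathcal{H}^{s}$ measure. $\fint$ denotes the average with respect to Lebesgue measure, and $u_{B_\varepsilon(x)}:=\fint_{B_\varepsilon(x)}u(w)\,dw$. For $1\le q<\infty$ and an open set $\Omega$, $u\in BV^q(\Omega,\mathbb{R}^d)$ means $u\in L^q(\Omega,\mathbb{R}^d)$ and $$\sup_{\epsilon\in(0,1)}\int_{\Omega}\left(\int_{\Omega\cap B_\epsilon(x)}\frac{1}{\epsilon^N}\frac{|u(x)-u(y)|^q}{|x-y|}\,dy\right)dx<\infty$$ (equivalently, the $\limsup$ as $\epsilon\to0^+$ of this expression is finite). $u\in BV^q_{loc}(\Omega,\mathbb{R}^d)$ means $u\in L^q_{loc}(\Omega,\mathbb{R}^d)$ and $u\in BV^q(\Omega_0,\mathbb{R}^d)$ for every open $\Omega_0\subset\subset\Omega$.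 For $u\in L^1_{loc}(\Omega,\mathbb{R}^d)$, $\mathcal{S}''_u$ is the set of points $x\in\Omega$ for which the property $$\liminf_{\rho\to0^+}\left(\inf_{c\in\mathbb{R}^d}\fint_{B_\rho(x)}|u(y)-c|\,dy\right)=0$$ does not hold. *)

theory Defs
  imports "HOL-Analysis.Analysis"
begin

text \<open>
  The sets of a cover must be bounded because \<^const>\<open>diameter\<close> is unspecified on unbounded sets.
  In the gauge, the convention that a nonempty set has \<open>(diam/2)\<^sup>0 = 1\<close> is made explicit,
  since \<open>0 powr 0 = 0\<close>.  The result is an outer measure, defined on all sets; a set of outer
  measure 0 is null in the usual sense.
\<close>

definition hausdorff_gauge :: "real \<Rightarrow> 'a::metric_space set \<Rightarrow> ennreal" where
  "hausdorff_gauge s E =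
     (if E = {} then 0
      else ennreal (unit_ball_vol s * (if s = 0 then 1 else (diameter E / 2) powr s)))"

definition hausdorff_premeasure :: "real \<Rightarrow> real \<Rightarrow> 'a::metric_space set \<Rightarrow> ennreal" where
  "hausdorff_premeasure s \<delta> A =
     (INF C \<in> {C :: nat \<Rightarrow> 'a set. A \<subseteq> (\<Union>i. C i) \<and> (\<forall>i. bounded (C i) \<and> diameter (C i) \<le> \<delta>)}.
        \<Sum>i. hausdorff_gauge s (C i))"

definition hausdorff_measure :: "real \<Rightarrow> 'a::metric_space set \<Rightarrow> ennreal" where
  "hausdorff_measure s A = (SUP \<delta> \<in> {0<..}. hausdorff_premeasure s \<delta> A)"

definition hausdorff_sigma_finite :: "real \<Rightarrow> 'a::metric_space set \<Rightarrow> bool" where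
  "hausdorff_sigma_finite s A \<longleftrightarrow>
     (\<exists>F :: nat \<Rightarrow> 'a set. A = (\<Union>i. F i) \<and> (\<forall>i. hausdorff_measure s (F i) < \<infinity>))"

definition average :: "'a::euclidean_space set \<Rightarrow> ('a \<Rightarrow> 'b::euclidean_space) \<Rightarrow> 'b" where
  "average E f = (1 / measure lebesgue E) *\<^sub>R (LINT x:E|lebesgue. f x)"

text \<open>
  Functions on \<open>\<Omega>\<close> are represented by total functions whose values outside \<open>\<Omega>\<close> are irrelevant.
\<close>

definition Lq :: "real \<Rightarrow> 'a::euclidean_space set \<Rightarrow> ('a \<Rightarrow> 'b::euclidean_space) set" where
  "Lq q \<Omega> = {u. u \<in> borel_measurable (lebesgue_on \<Omega>) \<and>
                integrable (lebesgue_on \<Omega>) (\<lambda>x. norm (u x) powr q)}"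

definition Lq_loc :: "real \<Rightarrow> 'a::euclidean_space set \<Rightarrow> ('a \<Rightarrow> 'b::euclidean_space) set" where
  "Lq_loc q \<Omega> = {u. \<forall>K. compact K \<and> K \<subseteq> \<Omega> \<longrightarrow> u \<in> Lq q K}"

definition BVq :: "real \<Rightarrow> 'a::euclidean_space set \<Rightarrow> ('a \<Rightarrow> 'b::euclidean_space) set" where
  "BVq q \<Omega> = {u \<in> Lq q \<Omega>.
     (SUP \<epsilon> \<in> {0<..<1}.
        \<integral>\<^sup>+ x. (\<integral>\<^sup>+ y. ennreal (1 / \<epsilon> ^ DIM('a) * (norm (u x - u y) powr q / norm (x - y)))
                 \<partial>lebesgue_on (\<Omega> \<inter> ball x \<epsilon>)) \<partial>lebesgue_on \<Omega>) < \<infinity>}"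

definition BVq_loc :: "real \<Rightarrow> 'a::euclidean_space set \<Rightarrow> ('a \<Rightarrow> 'b::euclidean_space) set" where
  "BVq_loc q \<Omega> = {u \<in> Lq_loc q \<Omega>.
     \<forall>\<Omega>\<^sub>0. open \<Omega>\<^sub>0 \<and> compact (closure \<Omega>\<^sub>0) \<and> closure \<Omega>\<^sub>0 \<subseteq> \<Omega> \<longrightarrow> u \<in> BVq q \<Omega>\<^sub>0}"

text \<open>
  The set \<open>S''\<^sub>u\<close>.  For \<open>x \<in> \<Omega>\<close> open and all small \<open>\<rho>\<close>, the closed ball around \<open>x\<close> lies in \<open>\<Omega>\<close>, so
  for locally integrable \<open>u\<close> the averages entering the lower limit are those of integrable functions.
\<close>

definition singular_set ::
    "'a::euclidean_space set \<Rightarrow> ('a \<Rightarrow> 'b::euclidean_space) \<Rightarrow> 'a set" where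
  "singular_set \<Omega> u =
     {x \<in> \<Omega>. \<not> Liminf (at_right 0)
        (\<lambda>\<rho>. INF c. ereal (average (ball x \<rho>) (\<lambda>y. norm (u y - c)))) = 0}"

end

theory Submission
  imports Defs
begin

text \<open>
  If the lower limit is positive at \<open>x\<close>, then all small balls \<open>B\<close> around \<open>x\<close> satisfy
  \<open>\<integral>\<^sub>B\<integral>\<^sub>B |u(y) - u(z)|\<^sup>q \<ge> c |B|\<^sup>2\<close> by Jensen's inequality.  As \<open>|y - z| < 2\<epsilon>\<close> on a ball of radius
  \<open>\<epsilon>\<close>, the left side is at most \<open>(2\<epsilon>)\<^bsup>N+1\<^esup>\<close> times the share of \<open>B\<close> in the nonlocal energy at scale
  \<open>2\<epsilon>\<close>.  Summing over a maximal disjoint family of such balls bounds their number by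
  \<open>C \<epsilon>\<^bsup>1-N\<^esup>\<close>, and the balls of twice the radius cover, so the points with uniform constants form a
  set of finite \<open>\<H>\<^bsup>N-1\<^esup>\<close> measure.  Since the covers consist of finitely many closed balls,
  the bound even holds for the closure of this set.
\<close>

section \<open>From packing bounds to finite Hausdorff measure\<close>

lemma hausdorff_measure_closure_less_top:
  fixes A :: "'a::real_normed_vector set"
  assumes "0 < r"
    and packing: "\<And>\<epsilon> X. \<lbrakk>0 < \<epsilon>; \<epsilon> < r; finite X; X \<subseteq> A; disjoint_family_on (\<lambda>x. ball x \<epsilon>) X\<rbrakk>
      \<Longrightarrow> real (card X) * \<epsilon> ^ n \<le> C"
  shows "hausdorff_measure (real n) (closure A) < \<infinity>"
proof -
  define V where "V = unit_ball_vol (real n)"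
  have V: "V \<ge> 0"
    by (simp add: V_def)
  have "hausdorff_premeasure (real n) \<delta> (closure A) \<le> ennreal (V * 2 ^ n * C)" if "\<delta> > 0" for \<delta>
  proof -
    \<comment> \<open>Below \<open>r\<close>, so that the packing hypothesis applies, and small
      enough that the covering balls of radius \<open>2 * \<epsilon>\<close> have diameter at most
      \<open>\<delta>\<close>.\<close>
    define \<epsilon> where "\<epsilon> = min (r / 2) (\<delta> / 4)"
    have \<epsilon>: "0 < \<epsilon>" "\<epsilon> < r" "4 * \<epsilon> \<le> \<delta>"
      using \<open>0 < r\<close> \<open>\<delta> > 0\<close> by (auto simp: \<epsilon>_def min_def)
    define P where "P X \<longleftrightarrow> finite X \<and> X \<subseteq> A \<and> disjoint_family_on (\<lambda>x. ball x \<epsilon>) X" for X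
    have "P {}"
      by (auto simp: P_def disjoint_family_on_def)
    \<comment> \<open>The packing hypothesis bounds the size of all disjoint families at this scale,
      so one of largest size exists. \<open>Suc\<close> turns the bound into the strict one that
      \<open>ex_has_greatest_nat\<close> asks for.\<close>
    moreover have "card X < Suc (nat \<lceil>C / \<epsilon> ^ n\<rceil>)" if "P X" for X
    proof -
      have "real (card X) \<le> C / \<epsilon> ^ n"
        using packing[of \<epsilon> X] that \<epsilon> by (simp add: P_def field_simps)
      then show ?thesis by linarith
    qed
    ultimately obtain X where X: "P X" and max: "\<And>Y. P Y \<Longrightarrow> card Y \<le> card X"
      using ex_has_greatest_nat[of P "{}" card] by meson
    have fin: "finite X" using X by (simp add: P_def)
    have "A \<subseteq> (\<Union>x\<in>X. cball x (2 * \<epsilon>))"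
    proof
      fix y assume "y \<in> A"
      show "y \<in> (\<Union>x\<in>X. cball x (2 * \<epsilon>))"
      proof (rule ccontr)
        assume no: "y \<notin> (\<Union>x\<in>X. cball x (2 * \<epsilon>))"
        \<comment> \<open>A point missed by all the doubled balls has an
          \<open>\<epsilon>\<close>-ball disjoint from those around \<open>X\<close>, so it could be
          added to \<open>X\<close>, against maximality.\<close>
        then have far: "dist x y > 2 * \<epsilon>" if "x \<in> X" for x
          using that by (auto simp: not_le)
        then have "y \<notin> X" using \<epsilon>(1) by force
        have "ball x \<epsilon> \<inter> ball y \<epsilon> = {}" if "x \<in> X" for x
          using far[OF that] by (intro disjoint_ballI) simp
        then have "P (insert y X)"
          using X \<open>y \<in> A\<close> by (fastforce simp: P_def disjoint_family_on_def)
        then show False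
          using max[of "insert y X"] fin \<open>y \<notin> X\<close> by simp
      qed
    qed
    \<comment> \<open>A finite union of closed balls is closed, so it contains the closure of
      \<open>A\<close> as well.\<close>
    then have cover: "closure A \<subseteq> (\<Union>x\<in>X. cball x (2 * \<epsilon>))"
      using fin by (intro closure_minimal) auto
    obtain f where f: "bij_betw f {..<card X} X"
      using fin by (metis bij_betw_from_nat_into_finite)
    \<comment> \<open>The premeasure takes covers indexed by all naturals; the finite cover is
      padded with empty sets, whose gauge is 0.\<close>
    define Cov where "Cov i = (if i < card X then cball (f i) (2 * \<epsilon>) else {})" for i
    have diam: "bounded (Cov i)" "diameter (Cov i) \<le> 4 * \<epsilon>" for i
    proof -
      show "bounded (Cov i)" by (simp add: Cov_def)
      show "diameter (Cov i) \<le> 4 * \<epsilon>"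
      proof (cases "i < card X")
        case True
        have "dist a b \<le> 4 * \<epsilon>" if "a \<in> cball (f i) (2 * \<epsilon>)" "b \<in> cball (f i) (2 * \<epsilon>)" for a b
          using that dist_triangle_le[of a "f i" b "4 * \<epsilon>"] by (simp add: dist_commute)
        then show ?thesis
          using True \<epsilon> by (intro diameter_le) (auto simp: Cov_def dist_norm)
      qed (use \<epsilon> in \<open>simp add: Cov_def\<close>)
    qed
    \<comment> \<open>For \<open>n = 0\<close> the gauge is the constant \<open>V\<close> on
      nonempty sets by convention, so this case avoids \<open>powr\<close>.\<close>
    have gauge: "hausdorff_gauge (real n) (Cov i) \<le> ennreal (V * (2 * \<epsilon>) ^ n)" for i
    proof (cases "n = 0")
      case False
      have "(diameter (Cov i) / 2) powr real n \<le> (2 * \<epsilon>) powr real n"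
        using diam[of i] diameter_ge_0[of "Cov i"] by (intro powr_mono2) auto
      then show ?thesis
        using False \<epsilon> V by (auto simp: hausdorff_gauge_def V_def powr_realpow intro!: ennreal_leI mult_left_mono)
    qed (auto simp: hausdorff_gauge_def V_def)
    have "closure A \<subseteq> (\<Union>i. Cov i)"
    proof
      fix y assume "y \<in> closure A"
      then obtain x where "x \<in> X" "y \<in> cball x (2 * \<epsilon>)"
        using cover by auto
      moreover obtain i where "i < card X" "f i = x"
        using f \<open>x \<in> X\<close> by (metis bij_betw_imp_surj_on imageE lessThan_iff)
      ultimately show "y \<in> (\<Union>i. Cov i)"
        by (auto simp: Cov_def)
    qed
    then have "hausdorff_premeasure (real n) \<delta> (closure A) \<le> (\<Sum>i. hausdorff_gauge (real n) (Cov i))"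
      unfolding hausdorff_premeasure_def using diam \<epsilon> by (intro INF_lower) (auto intro: order_trans)
    also have "\<dots> = (\<Sum>i<card X. hausdorff_gauge (real n) (Cov i))"
      by (intro suminf_finite) (auto simp: Cov_def hausdorff_gauge_def)
    also have "\<dots> \<le> (\<Sum>i<card X. ennreal (V * (2 * \<epsilon>) ^ n))"
      by (intro sum_mono gauge)
    also have "\<dots> = ennreal (real (card X) * (V * (2 * \<epsilon>) ^ n))"
      using V \<epsilon> by (simp add: ennreal_mult ennreal_of_nat_eq_real_of_nat)
    also have "\<dots> \<le> ennreal (V * 2 ^ n * C)"
    proof (rule ennreal_leI)
      have "real (card X) * \<epsilon> ^ n \<le> C"
        using packing[of \<epsilon> X] X \<epsilon> by (simp add: P_def)
      then have "(V * 2 ^ n) * (real (card X) * \<epsilon> ^ n) \<le> (V * 2 ^ n) * C"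
        using V by (intro mult_left_mono) auto
      then show "real (card X) * (V * (2 * \<epsilon>) ^ n) \<le> V * 2 ^ n * C"
        by (simp add: power_mult_distrib mult_ac)
    qed
    finally show ?thesis .
  qed
  then have "hausdorff_measure (real n) (closure A) \<le> ennreal (V * 2 ^ n * C)"
    unfolding hausdorff_measure_def by (intro SUP_least) simp
  then show ?thesis
    using ennreal_less_top le_less_trans by (metis infinity_ennreal_def)
qed

section \<open>Jensen's inequality for powers\<close>

text \<open>The tangent line of \<open>t powr q\<close> at the mean \<open>m\<close> lies below the
  graph; integrating it gives the claim. The degenerate cases are settled by default values: without
  integrability of \<open>f\<close>, or on a space of measure 0, the left side is 0, and if only the
  power fails to be integrable, the right side is infinite.\<close>

lemma powr_integral_average_le:
  assumes "finite_measure M" "f \<in> borel_measurable M" "\<And>x. 0 \<le> f x" "1 \<le> q"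
  shows "ennreal (measure M (space M) * (integral\<^sup>L M f / measure M (space M)) powr q)
     \<le> (\<integral>\<^sup>+x. ennreal (f x powr q) \<partial>M)"
proof (cases "integrable M f \<and> integrable M (\<lambda>x. f x powr q) \<and> measure M (space M) > 0")
  case True
  interpret finite_measure M by fact
  define V where "V = measure M (space M)"
  define m where "m = integral\<^sup>L M f / V"
  have int: "integrable M f" "integrable M (\<lambda>x. f x powr q)" and V: "V > 0"
    using True by (auto simp: V_def)
  have m: "m \<ge> 0"
    using assms(3) V by (simp add: m_def)
  \<comment> \<open>The tangent inequality at \<open>m\<close>, rearranged. It is Young's inequality
    for \<open>t powr q\<close> and \<open>m powr q\<close> with weights \<open>1 / q\<close> and
    \<open>1 - 1 / q\<close>, multiplied by \<open>q\<close>.\<close>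
  have young: "q * m powr (q - 1) * t \<le> t powr q + (q - 1) * m powr q" if "t \<ge> 0" for t
  proof (cases "t = 0 \<or> m = 0")
    case True
    then show ?thesis using assms(4) by auto
  next
    case False
    then have "(t powr q) powr (1 / q) * (m powr q) powr (1 - 1 / q)
        \<le> 1 / q * t powr q + (1 - 1 / q) * m powr q"
      using assms(4) m that by (intro Youngs_inequality_0) auto
    moreover have "(t powr q) powr (1 / q) = t" "(m powr q) powr (1 - 1 / q) = m powr (q - 1)"
      using assms(4) that by (auto simp: powr_powr right_diff_distrib)
    ultimately have "q * (t * m powr (q - 1)) \<le> q * (1 / q * t powr q + (1 - 1 / q) * m powr q)"
      using assms(4) by (intro mult_left_mono) auto
    also have "\<dots> = t powr q + (q - 1) * m powr q"
      using assms(4) by (simp add: field_simps)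
    finally show ?thesis by (simp add: mult_ac)
  qed
  have "(\<integral>x. q * m powr (q - 1) * f x \<partial>M) \<le> (\<integral>x. f x powr q + (q - 1) * m powr q \<partial>M)"
    using int assms(3) young by (intro integral_mono) auto
  then have "q * m powr (q - 1) * (m * V) \<le> (\<integral>x. f x powr q \<partial>M) + (q - 1) * m powr q * V"
    using int V by (simp add: m_def V_def mult_ac)
  moreover have "m powr (q - 1) * m = m powr q"
    using m by (cases "m = 0") (auto simp: powr_diff)
  then have "q * m powr (q - 1) * (m * V) = q * m powr q * V"
    by (metis mult.assoc)
  ultimately have "q * m powr q * V \<le> (\<integral>x. f x powr q \<partial>M) + (q - 1) * m powr q * V"
    by linarith
  then have "V * m powr q \<le> (\<integral>x. f x powr q \<partial>M)"
    by (simp add: algebra_simps)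
  then show ?thesis
    using int by (simp add: nn_integral_eq_integral V_def m_def ennreal_leI)
next
  case False
  consider "\<not> integrable M f" | "\<not> integrable M (\<lambda>x. f x powr q)" | "measure M (space M) = 0"
    using False zero_less_measure_iff by blast
  then show ?thesis
  proof cases
    case 1
    then show ?thesis by (simp add: not_integrable_integral_eq)
  next
    case 2
    then have "\<not> (\<integral>\<^sup>+x. ennreal (f x powr q) \<partial>M) < \<infinity>"
      using assms(2) by (simp add: integrable_iff_bounded)
    then have "(\<integral>\<^sup>+x. ennreal (f x powr q) \<partial>M) = \<infinity>"
      by (metis infinity_ennreal_def top.not_eq_extremum)
    then show ?thesis by simp
  qed simp
qed

section \<open>The nonlocal energy on disjoint balls\<close>

text \<open>Needed for the measurability of inner integrals in the outer variable. Completion does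
  not change the measure of Borel sets, so a countable cover for \<open>lborel\<close> serves
  again.\<close>

lemma sigma_finite_lebesgue: "sigma_finite_measure lebesgue"
proof
  obtain A :: "'a set set" where "countable A" "A \<subseteq> sets lborel" "\<Union>A = space lborel"
     "\<forall>a\<in>A. emeasure lborel a \<noteq> \<infinity>"
    using sigma_finite_measure.sigma_finite_countable[OF sigma_finite_lborel] by metis
  then show "\<exists>A :: 'a set set. countable A \<and> A \<subseteq> sets lebesgue \<and> \<Union>A = space lebesgue
      \<and> (\<forall>a\<in>A. emeasure lebesgue a \<noteq> \<infinity>)"
    by (intro exI[of _ A]) (auto simp: emeasure_completion subset_iff)
qed


text \<open>Two points of a ball of radius \<open>\<epsilon>\<close> are less than
  \<open>2 * \<epsilon>\<close> apart, so the pairs in the ball are among those counted by the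
  energy at scale \<open>2 * \<epsilon>\<close>, where the kernel loses at most the factor
  \<open>(2 * \<epsilon>) ^ (DIM('a) + 1)\<close>. Disjointness keeps the sum below a single
  integral over \<open>U\<close>. The bound \<open>M\<close> is the supremum over the scales below
  1, whence \<open>2 * \<epsilon> < 1\<close>.\<close>

lemma BVq_energy_on_disjoint_balls:
  fixes u :: "'a::euclidean_space \<Rightarrow> 'b::euclidean_space"
  assumes u: "u \<in> BVq q U" and "open U"
  obtains M :: real where "0 \<le> M"
    and "\<And>\<epsilon> X. \<lbrakk>0 < \<epsilon>; 2 * \<epsilon> < 1; finite X; \<And>x. x \<in> X \<Longrightarrow> ball x \<epsilon> \<subseteq> U;
        disjoint_family_on (\<lambda>x. ball x \<epsilon>) X\<rbrakk>
      \<Longrightarrow> (\<Sum>x\<in>X. \<integral>\<^sup>+y. (\<integral>\<^sup>+z. ennreal (norm (u y - u z) powr q)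
            \<partial>lebesgue_on (ball x \<epsilon>)) \<partial>lebesgue_on (ball x \<epsilon>))
          \<le> ennreal ((2 * \<epsilon>) ^ (DIM('a) + 1) * M)"
proof -
  define J where "J \<epsilon> = (\<integral>\<^sup>+x. (\<integral>\<^sup>+y. ennreal (1 / \<epsilon> ^ DIM('a) * (norm (u x - u y) powr q / norm (x - y)))
                 \<partial>lebesgue_on (U \<inter> ball x \<epsilon>)) \<partial>lebesgue_on U)" for \<epsilon> :: real
  have "(SUP \<epsilon> \<in> {0<..<1}. J \<epsilon>) < \<infinity>"
    using u by (simp add: BVq_def J_def)
  then obtain M where M: "0 \<le> M" "(SUP \<epsilon> \<in> {0<..<1}. J \<epsilon>) = ennreal M"
    by (cases "SUP \<epsilon> \<in> {0<..<1}. J \<epsilon>") auto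
  have J: "J \<epsilon> \<le> ennreal M" if "0 < \<epsilon>" "\<epsilon> < 1" for \<epsilon>
    unfolding M(2)[symmetric] using that by (intro SUP_upper) auto
  have [measurable]: "U \<in> sets lebesgue"
    using \<open>open U\<close> by auto
  \<comment> \<open>\<open>u\<close> is measurable on \<open>U\<close> only; its extension by zero
    is measurable on the whole space.\<close>
  define v where "v x = (if x \<in> U then u x else 0)" for x
  have [measurable]: "v \<in> borel_measurable lebesgue"
    using u unfolding v_def BVq_def Lq_def by (auto intro!: borel_measurable_if_I)
  have [measurable]: "ball x \<epsilon> \<in> sets lebesgue" for x :: 'a and \<epsilon>
    by simp
  have [measurable]: "(\<lambda>x::'a. x) \<in> borel_measurable lebesgue"
    by (simp add: measurable_completion)
  interpret L: sigma_finite_measure "lebesgue :: 'a measure"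
    by (rule sigma_finite_lebesgue)
  show thesis
  proof (rule that[OF M(1)])
    fix \<epsilon> :: real and X :: "'a set"
    assume \<epsilon>: "0 < \<epsilon>" "2 * \<epsilon> < 1" and X: "finite X" "\<And>x. x \<in> X \<Longrightarrow> ball x \<epsilon> \<subseteq> U"
      "disjoint_family_on (\<lambda>x. ball x \<epsilon>) X"
    \<comment> \<open>The energy integrand at scale \<open>2 * \<epsilon>\<close>. The inner domain
      varies with \<open>y\<close>, so it is encoded by indicators on the product space, where joint
      measurability can be shown.\<close>
    define K where "K y z = ennreal (1 / (2 * \<epsilon>) ^ DIM('a) * (norm (v y - v z) powr q / norm (y - z)))
        * indicator U z * indicator {p. dist (fst p) (snd p) < 2 * \<epsilon>} (y, z)" for y z
    define F where "F y = (\<integral>\<^sup>+z. K y z \<partial>lebesgue)" for y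
    define c where "c = (2 * \<epsilon>) ^ (DIM('a) + 1)"
    have Kmeas: "case_prod K \<in> borel_measurable (lebesgue \<Otimes>\<^sub>M lebesgue)"
      unfolding K_def split_def by measurable
    then have [measurable]: "F \<in> borel_measurable lebesgue"
      unfolding F_def by measurable
    have [measurable]: "K y \<in> borel_measurable lebesgue" for y
      using measurable_Pair2[OF Kmeas, of y] by simp
    have inner: "(\<integral>\<^sup>+z. ennreal (norm (u y - u z) powr q) \<partial>lebesgue_on (ball x \<epsilon>)) \<le> ennreal c * F y"
      if x: "x \<in> X" and y: "y \<in> ball x \<epsilon>" for x y
    proof -
      have "(\<integral>\<^sup>+z. ennreal (norm (u y - u z) powr q) \<partial>lebesgue_on (ball x \<epsilon>))
          = (\<integral>\<^sup>+z. ennreal (norm (u y - u z) powr q) * indicator (ball x \<epsilon>) z \<partial>lebesgue)"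
        by (simp add: nn_integral_restrict_space)
      also have "\<dots> \<le> (\<integral>\<^sup>+z. ennreal c * K y z \<partial>lebesgue)"
      proof (rule nn_integral_mono)
        fix z
        show "ennreal (norm (u y - u z) powr q) * indicator (ball x \<epsilon>) z \<le> ennreal c * K y z"
        proof (cases "z \<in> ball x \<epsilon>")
          case True
          have "y \<in> U" "z \<in> U"
            using X(2)[OF x] True y by auto
          moreover have d: "dist y z < 2 * \<epsilon>"
            using True y dist_triangle_less_add[of y x \<epsilon> z \<epsilon>] by (simp add: dist_commute)
          \<comment> \<open>The power of order \<open>DIM('a)\<close> in \<open>c\<close> cancels
            the normalisation, and the remaining factor \<open>2 * \<epsilon>\<close> absorbs
            \<open>1 / norm (y - z)\<close>. On the diagonal both sides are 0.\<close>
          moreover have "norm (u y - u z) powr q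
              \<le> c * (1 / (2 * \<epsilon>) ^ DIM('a) * (norm (u y - u z) powr q / norm (y - z)))"
          proof (cases "y = z")
            case False
            have "1 \<le> 2 * \<epsilon> / norm (y - z)"
              using d False by (simp add: dist_norm field_simps)
            then have "norm (u y - u z) powr q * 1 \<le> norm (u y - u z) powr q * (2 * \<epsilon> / norm (y - z))"
              by (intro mult_left_mono) auto
            also have "\<dots> = c * (1 / (2 * \<epsilon>) ^ DIM('a) * (norm (u y - u z) powr q / norm (y - z)))"
              using \<epsilon> by (simp add: c_def)
            finally show ?thesis by simp
          qed simp
          ultimately show ?thesis
            using True \<epsilon> by (simp add: K_def v_def c_def ennreal_mult[symmetric] ennreal_leI)
        qed simp
      qed
      also have "\<dots> = ennreal c * F y"
        unfolding F_def by (intro nn_integral_cmult) measurable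
      finally show ?thesis .
    qed
    have "(\<Sum>x\<in>X. \<integral>\<^sup>+y. (\<integral>\<^sup>+z. ennreal (norm (u y - u z) powr q)
            \<partial>lebesgue_on (ball x \<epsilon>)) \<partial>lebesgue_on (ball x \<epsilon>))
        \<le> (\<Sum>x\<in>X. \<integral>\<^sup>+y. ennreal c * F y * indicator (ball x \<epsilon>) y \<partial>lebesgue)"
    proof (rule sum_mono)
      fix x assume x: "x \<in> X"
      have "(\<integral>\<^sup>+y. (\<integral>\<^sup>+z. ennreal (norm (u y - u z) powr q)
            \<partial>lebesgue_on (ball x \<epsilon>)) \<partial>lebesgue_on (ball x \<epsilon>))
          \<le> (\<integral>\<^sup>+y. ennreal c * F y \<partial>lebesgue_on (ball x \<epsilon>))"
        using inner[OF x] by (intro nn_integral_mono) (simp add: space_restrict_space)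
      then show "(\<integral>\<^sup>+y. (\<integral>\<^sup>+z. ennreal (norm (u y - u z) powr q)
            \<partial>lebesgue_on (ball x \<epsilon>)) \<partial>lebesgue_on (ball x \<epsilon>))
          \<le> (\<integral>\<^sup>+y. ennreal c * F y * indicator (ball x \<epsilon>) y \<partial>lebesgue)"
        by (simp add: nn_integral_restrict_space)
    qed
    also have "\<dots> = (\<integral>\<^sup>+y. (\<Sum>x\<in>X. ennreal c * F y * indicator (ball x \<epsilon>) y) \<partial>lebesgue)"
      by (intro nn_integral_sum[symmetric]) measurable
    also have "\<dots> \<le> (\<integral>\<^sup>+y. ennreal c * (F y * indicator U y) \<partial>lebesgue)"
    proof (rule nn_integral_mono)
      fix y
      \<comment> \<open>Here disjointness enters: each \<open>y\<close> is counted at most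
        once.\<close>
      have "(\<Sum>x\<in>X. indicator (ball x \<epsilon>) y) = (indicator (\<Union>x\<in>X. ball x \<epsilon>) y :: ennreal)"
        using X by (intro indicator_UN_disjoint[symmetric]) auto
      also have "\<dots> \<le> indicator U y"
      proof -
        have "(\<Union>x\<in>X. ball x \<epsilon>) \<subseteq> U"
          using X(2) by blast
        then show ?thesis
          by (auto simp: indicator_def subset_iff)
      qed
      finally show "(\<Sum>x\<in>X. ennreal c * F y * indicator (ball x \<epsilon>) y) \<le> ennreal c * (F y * indicator U y)"
        by (simp add: sum_distrib_left[symmetric] mult.assoc mult_left_mono)
    qed
    also have "\<dots> = ennreal c * (\<integral>\<^sup>+y. F y * indicator U y \<partial>lebesgue)"
      by (intro nn_integral_cmult) measurable
    also have "(\<integral>\<^sup>+y. F y * indicator U y \<partial>lebesgue) = J (2 * \<epsilon>)"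
    proof -
      have "F y = (\<integral>\<^sup>+z. ennreal (1 / (2 * \<epsilon>) ^ DIM('a) * (norm (u y - u z) powr q / norm (y - z)))
                 \<partial>lebesgue_on (U \<inter> ball y (2 * \<epsilon>)))" if "y \<in> U" for y
        using that unfolding F_def K_def v_def
        by (subst nn_integral_restrict_space) (auto intro!: nn_integral_cong simp: indicator_def)
      then show ?thesis
        unfolding J_def
        by (subst nn_integral_restrict_space) (auto intro!: nn_integral_cong simp: indicator_def)
    qed
    also have "ennreal c * J (2 * \<epsilon>) \<le> ennreal c * ennreal M"
      using J[of "2 * \<epsilon>"] \<epsilon> by (intro mult_left_mono) auto
    also have "\<dots> = ennreal ((2 * \<epsilon>) ^ (DIM('a) + 1) * M)"
      using M \<epsilon> by (simp add: c_def ennreal_mult)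
    finally show "(\<Sum>x\<in>X. \<integral>\<^sup>+y. (\<integral>\<^sup>+z. ennreal (norm (u y - u z) powr q)
            \<partial>lebesgue_on (ball x \<epsilon>)) \<partial>lebesgue_on (ball x \<epsilon>))
          \<le> ennreal ((2 * \<epsilon>) ^ (DIM('a) + 1) * M)" .
  qed
qed

text \<open>For disjoint balls around points of \<open>A\<close>, the lower bounds add up to a
  multiple of \<open>card X * \<epsilon> ^ (2 * DIM('a))\<close>, and the energy allows at most a
  multiple of \<open>\<epsilon> ^ (DIM('a) + 1)\<close>. The quotient is the packing bound in
  dimension one less.\<close>

lemma BVq_hausdorff_measure_closure_less_top:
  fixes u :: "'a::euclidean_space \<Rightarrow> 'b::euclidean_space"
  assumes u: "u \<in> BVq q U" and "open U" and "0 < r" "0 < c"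
    and ball: "\<And>x. x \<in> A \<Longrightarrow> ball x r \<subseteq> U"
    and lower: "\<And>x \<rho>. \<lbrakk>x \<in> A; 0 < \<rho>; \<rho> < r\<rbrakk> \<Longrightarrow>
      ennreal (c * (measure lborel (ball x \<rho>))\<^sup>2) \<le>
        (\<integral>\<^sup>+y. (\<integral>\<^sup>+z. ennreal (norm (u y - u z) powr q)
            \<partial>lebesgue_on (ball x \<rho>)) \<partial>lebesgue_on (ball x \<rho>))"
  shows "hausdorff_measure (real DIM('a) - 1) (closure A) < \<infinity>"
proof -
  obtain M where "0 \<le> M" and M: "\<And>\<epsilon> X. \<lbrakk>0 < \<epsilon>; 2 * \<epsilon> < 1; finite X; \<And>x. x \<in> X \<Longrightarrow> ball x \<epsilon> \<subseteq> U;
        disjoint_family_on (\<lambda>x. ball x \<epsilon>) X\<rbrakk>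
      \<Longrightarrow> (\<Sum>x\<in>X. \<integral>\<^sup>+y. (\<integral>\<^sup>+z. ennreal (norm (u y - u z) powr q)
            \<partial>lebesgue_on (ball x \<epsilon>)) \<partial>lebesgue_on (ball x \<epsilon>))
          \<le> ennreal ((2 * \<epsilon>) ^ (DIM('a) + 1) * M)"
    using BVq_energy_on_disjoint_balls[OF u \<open>open U\<close>] by blast
  define \<omega> where "\<omega> = unit_ball_vol (real DIM('a))"
  \<comment> \<open>The Hausdorff dimension as a natural number, so that ordinary powers can be
    used.\<close>
  obtain n where n: "DIM('a) = Suc n"
    using DIM_positive by (metis gr0_implies_Suc)
  have \<omega>: "\<omega> > 0" by (simp add: \<omega>_def)
  \<comment> \<open>The bound \<open>1 / 2\<close> keeps the energy scale
    \<open>2 * \<epsilon>\<close> below 1.\<close>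
  have "real (card X) * \<epsilon> ^ n \<le> 2 ^ (n + 2) * M / (c * \<omega>\<^sup>2)"
    if \<epsilon>: "0 < \<epsilon>" "\<epsilon> < min r (1 / 2)" and X: "finite X" "X \<subseteq> A"
      "disjoint_family_on (\<lambda>x. ball x \<epsilon>) X" for \<epsilon> X
  proof -
    have "ennreal (real (card X) * (c * (\<omega> * \<epsilon> ^ Suc n)\<^sup>2)) = (\<Sum>x\<in>X. ennreal (c * (measure lborel (ball x \<epsilon>))\<^sup>2))"
      using \<epsilon> \<open>c > 0\<close> by (simp add: content_ball \<omega>_def n ennreal_mult ennreal_of_nat_eq_real_of_nat)
    also have "\<dots> \<le> (\<Sum>x\<in>X. \<integral>\<^sup>+y. (\<integral>\<^sup>+z. ennreal (norm (u y - u z) powr q)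
            \<partial>lebesgue_on (ball x \<epsilon>)) \<partial>lebesgue_on (ball x \<epsilon>))"
      using X \<epsilon> by (intro sum_mono lower) auto
    also have "\<dots> \<le> ennreal ((2 * \<epsilon>) ^ (DIM('a) + 1) * M)"
    proof (rule M)
      show "ball x \<epsilon> \<subseteq> U" if "x \<in> X" for x
        using ball[of x] that X \<epsilon> by (auto simp: subset_iff)
    qed (use \<epsilon> X in auto)
    finally have "real (card X) * (c * (\<omega> * \<epsilon> ^ Suc n)\<^sup>2) \<le> (2 * \<epsilon>) ^ (n + 2) * M"
      using \<open>M \<ge> 0\<close> \<epsilon> by (simp add: n ennreal_le_iff)
    \<comment> \<open>The squared volume carries \<open>\<epsilon> ^ (2 * n + 2)\<close>, split here
      so that \<open>\<epsilon> ^ (n + 2)\<close> cancels.\<close>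
    then have "\<epsilon> ^ (n + 2) * (real (card X) * \<epsilon> ^ n * (c * \<omega>\<^sup>2)) \<le> \<epsilon> ^ (n + 2) * (2 ^ (n + 2) * M)"
      by (simp add: power2_eq_square power_mult_distrib mult_ac)
    then have "real (card X) * \<epsilon> ^ n * (c * \<omega>\<^sup>2) \<le> 2 ^ (n + 2) * M"
      using \<epsilon> by (subst (asm) mult_le_cancel_left_pos) auto
    then show ?thesis
      using \<open>c > 0\<close> \<omega> by (simp add: field_simps)
  qed
  then have "hausdorff_measure (real n) (closure A) < \<infinity>"
    using \<open>r > 0\<close> by (intro hausdorff_measure_closure_less_top[where r = "min r (1/2)"]) auto
  then show ?thesis by (simp add: n)
qed

section \<open>Integrability and averages on balls\<close>

text \<open>On a set of finite measure \<open>1 + norm (u y) powr q\<close> is an integrable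
  majorant.\<close>

lemma Lq_integrable:
  fixes u :: "'a::euclidean_space \<Rightarrow> 'b::euclidean_space"
  assumes "u \<in> Lq q K" "1 \<le> q" "compact K"
  shows "integrable (lebesgue_on K) u"
proof -
  have K: "K \<in> sets lebesgue" "emeasure lebesgue K < \<infinity>"
    using \<open>compact K\<close> emeasure_compact_finite by (auto simp: fmeasurableD compact_imp_closed)
  then interpret finite_measure "lebesgue_on K"
    by (intro finite_measureI) (simp add: emeasure_restrict_space space_restrict_space)
  show ?thesis
  proof (rule Bochner_Integration.integrable_bound)
    show "integrable (lebesgue_on K) (\<lambda>y. 1 + norm (u y) powr q)"
      using assms(1) by (simp add: Lq_def)
    have "norm (u y) \<le> 1 + norm (u y) powr q" for y
    proof (cases "norm (u y) \<le> 1")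
      case False
      then have "norm (u y) powr 1 \<le> norm (u y) powr q"
        using assms(2) by (intro powr_mono) auto
      then show ?thesis using False by simp
    qed (simp add: add_increasing2)
    then show "AE y in lebesgue_on K. norm (u y) \<le> norm (1 + norm (u y) powr q)"
      by simp
  qed (use assms(1) in \<open>simp add: Lq_def\<close>)
qed

lemma Lq_integrable_ball:
  fixes u :: "'a::euclidean_space \<Rightarrow> 'b::euclidean_space"
  assumes "u \<in> Lq q K" "1 \<le> q" "compact K" "ball x r \<subseteq> K"
  shows "integrable (lebesgue_on (ball x r)) u"
proof -
  have "set_integrable lebesgue K u"
    using Lq_integrable[OF assms(1-3)] \<open>compact K\<close>
    by (simp add: integrable_restrict_space set_integrable_def fmeasurableD compact_imp_closed)
  then have "set_integrable lebesgue (ball x r) u"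
    by (rule set_integrable_subset) (use assms(4) in auto)
  then show ?thesis
    by (simp add: integrable_restrict_space set_integrable_def)
qed

lemma hausdorff_measure_empty: "hausdorff_measure s {} = 0"
proof -
  have "hausdorff_premeasure s \<delta> ({} :: 'a set) \<le> 0" if "\<delta> > 0" for \<delta>
  proof -
    have "hausdorff_premeasure s \<delta> ({} :: 'a set) \<le> (\<Sum>i::nat. hausdorff_gauge s ({} :: 'a set))"
      unfolding hausdorff_premeasure_def using that by (intro INF_lower) auto
    then show ?thesis by (simp add: hausdorff_gauge_def)
  qed
  then show ?thesis
    unfolding hausdorff_measure_def by (intro antisym SUP_least) auto
qed

lemma average_ball_eq:
  "average (ball x \<rho>) f =
    (1 / measure lborel (ball x \<rho>)) *\<^sub>R integral\<^sup>L (lebesgue_on (ball x \<rho>)) f"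
  by (simp add: average_def set_lebesgue_integral_def integral_restrict_space)

lemma average_ball_nonneg:
  fixes f :: "'a::euclidean_space \<Rightarrow> real"
  assumes "\<And>y. 0 \<le> f y"
  shows "0 \<le> average (ball x \<rho>) f"
  using assms by (simp add: average_ball_eq)

text \<open>Holds for every nonnegative \<open>f\<close>, since the Bochner integral of a
  nonintegrable function is 0.\<close>

lemma ennreal_integral_le_nn_integral:
  assumes "\<And>x. 0 \<le> f x"
  shows "ennreal (integral\<^sup>L M f) \<le> (\<integral>\<^sup>+x. ennreal (f x) \<partial>M)"
  using assms by (cases "integrable M f") (auto simp: nn_integral_eq_integral not_integrable_integral_eq)

lemma finite_measure_lebesgue_on_ball: "finite_measure (lebesgue_on (ball x \<rho>))"
  using emeasure_lborel_ball_finite[of x \<rho>]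
  by (intro finite_measureI) (auto simp: emeasure_restrict_space space_restrict_space)

lemma measure_lebesgue_on_ball:
  "measure (lebesgue_on (ball x \<rho>)) (ball x \<rho>) = measure lborel (ball x \<rho>)"
  by (simp add: measure_restrict_space)

lemma powr_average_ball_le:
  fixes f :: "'a::euclidean_space \<Rightarrow> real"
  assumes "f \<in> borel_measurable (lebesgue_on (ball x \<rho>))" "\<And>y. 0 \<le> f y" "1 \<le> q"
  shows "ennreal (measure lborel (ball x \<rho>) * average (ball x \<rho>) f powr q)
    \<le> (\<integral>\<^sup>+y. ennreal (f y powr q) \<partial>lebesgue_on (ball x \<rho>))"
  using powr_integral_average_le[OF finite_measure_lebesgue_on_ball assms]
  by (simp add: average_ball_eq measure_lebesgue_on_ball)

section \<open>Lower bounds for the double integral over a ball\<close>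

text \<open>For each \<open>y\<close> the constant \<open>c = u y\<close> is admissible, and
  Jensen's inequality in \<open>z\<close> bounds the inner integral from below by a number
  independent of \<open>y\<close>.\<close>

lemma double_integral_ge_of_average_norm_ge:
  fixes u :: "'a::euclidean_space \<Rightarrow> 'b::euclidean_space"
  assumes u: "u \<in> borel_measurable (lebesgue_on (ball x \<rho>))" and "1 \<le> q" and "0 < t"
    and ge: "\<And>c. t \<le> average (ball x \<rho>) (\<lambda>y. norm (u y - c))"
  shows "ennreal (t powr q * (measure lborel (ball x \<rho>))\<^sup>2) \<le>
        (\<integral>\<^sup>+y. (\<integral>\<^sup>+z. ennreal (norm (u y - u z) powr q)
            \<partial>lebesgue_on (ball x \<rho>)) \<partial>lebesgue_on (ball x \<rho>))"
proof -
  define V where "V = measure lborel (ball x \<rho>)"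
  have V: "V \<ge> 0" by (simp add: V_def)
  have "ennreal (V * t powr q) \<le> (\<integral>\<^sup>+z. ennreal (norm (u y - u z) powr q) \<partial>lebesgue_on (ball x \<rho>))" for y
  proof -
    have "ennreal (V * t powr q) \<le> ennreal (V * average (ball x \<rho>) (\<lambda>z. norm (u z - u y)) powr q)"
      using ge[of "u y"] assms V by (intro ennreal_leI mult_left_mono powr_mono2) auto
    also have "\<dots> \<le> (\<integral>\<^sup>+z. ennreal (norm (u z - u y) powr q) \<partial>lebesgue_on (ball x \<rho>))"
      unfolding V_def using u assms by (intro powr_average_ball_le) auto
    finally show ?thesis by (simp add: norm_minus_commute)
  qed
  then have "(\<integral>\<^sup>+y. ennreal (V * t powr q) \<partial>lebesgue_on (ball x \<rho>)) \<le>
        (\<integral>\<^sup>+y. (\<integral>\<^sup>+z. ennreal (norm (u y - u z) powr q)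
            \<partial>lebesgue_on (ball x \<rho>)) \<partial>lebesgue_on (ball x \<rho>))"
    by (intro nn_integral_mono)
  moreover have "emeasure (lebesgue_on (ball x \<rho>)) (space (lebesgue_on (ball x \<rho>))) = ennreal V"
    by (simp add: finite_measure.emeasure_eq_measure[OF finite_measure_lebesgue_on_ball]
        measure_lebesgue_on_ball V_def)
  ultimately show ?thesis
    using V by (simp add: V_def[symmetric] ennreal_mult[symmetric] power2_eq_square mult_ac)
qed

text \<open>The deviation of \<open>u y\<close> from the mean is the average of
  \<open>u y - u z\<close> over \<open>z\<close>, so Jensen's inequality bounds its power by the
  inner integral. As the power already occurs in the hypothesis, \<open>t\<close> enters
  linearly.\<close>

lemma double_integral_ge_of_average_deviation_ge:
  fixes u :: "'a::euclidean_space \<Rightarrow> 'b::euclidean_space"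
  assumes u: "integrable (lebesgue_on (ball x \<rho>)) u" and "1 \<le> q" and "0 < t" and "0 < \<rho>"
    and ge: "t \<le> average (ball x \<rho>) (\<lambda>y. norm (u y - average (ball x \<rho>) u) powr q)"
  shows "ennreal (t * (measure lborel (ball x \<rho>))\<^sup>2) \<le>
        (\<integral>\<^sup>+y. (\<integral>\<^sup>+z. ennreal (norm (u y - u z) powr q)
            \<partial>lebesgue_on (ball x \<rho>)) \<partial>lebesgue_on (ball x \<rho>))"
proof -
  let ?B = "lebesgue_on (ball x \<rho>)"
  interpret finite_measure ?B by (rule finite_measure_lebesgue_on_ball)
  define V where "V = measure lborel (ball x \<rho>)"
  define m where "m = average (ball x \<rho>) u"
  have V: "V > 0" using \<open>0 < \<rho>\<close> by (simp add: V_def)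
  have spaceV: "measure ?B (space ?B) = V"
    by (simp add: measure_lebesgue_on_ball V_def)
  have [measurable]: "u \<in> borel_measurable ?B" using u by auto
  have inner: "ennreal (V * norm (u y - m) powr q) \<le> (\<integral>\<^sup>+z. ennreal (norm (u y - u z) powr q) \<partial>?B)" for y
  proof -
    have "V *\<^sub>R (u y - m) = (\<integral>z. u y - u z \<partial>?B)"
      using u V spaceV by (simp add: m_def average_ball_eq V_def[symmetric] scaleR_diff_right)
    then have "V * norm (u y - m) \<le> (\<integral>z. norm (u y - u z) \<partial>?B)"
      using V by (metis integral_norm_bound norm_scaleR abs_of_pos)
    then have "norm (u y - m) \<le> average (ball x \<rho>) (\<lambda>z. norm (u y - u z))"
      using V by (simp add: average_ball_eq V_def[symmetric] field_simps)
    then have "ennreal (V * norm (u y - m) powr q) \<le> ennreal (V * average (ball x \<rho>) (\<lambda>z. norm (u y - u z)) powr q)"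
      using assms(2) V by (intro ennreal_leI mult_left_mono powr_mono2) auto
    also have "\<dots> \<le> (\<integral>\<^sup>+z. ennreal (norm (u y - u z) powr q) \<partial>?B)"
      unfolding V_def using assms(2) by (intro powr_average_ball_le) auto
    finally show ?thesis .
  qed
  have "t * V \<le> (\<integral>y. norm (u y - m) powr q \<partial>?B)"
    using ge V by (simp add: average_ball_eq[of x \<rho> "\<lambda>y. norm (u y - m) powr q"] V_def[symmetric] m_def[symmetric] field_simps)
  then have "ennreal (t * V) \<le> ennreal (\<integral>y. norm (u y - m) powr q \<partial>?B)"
    by (rule ennreal_leI)
  also have "\<dots> \<le> (\<integral>\<^sup>+y. ennreal (norm (u y - m) powr q) \<partial>?B)"
    by (rule ennreal_integral_le_nn_integral) simp
  finally have "ennreal V * ennreal (t * V) \<le> ennreal V * (\<integral>\<^sup>+y. ennreal (norm (u y - m) powr q) \<partial>?B)"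
    by (rule mult_left_mono) simp
  also have "\<dots> = (\<integral>\<^sup>+y. ennreal (V * norm (u y - m) powr q) \<partial>?B)"
    using V by (simp add: nn_integral_cmult[symmetric] ennreal_mult)
  also have "\<dots> \<le> (\<integral>\<^sup>+y. (\<integral>\<^sup>+z. ennreal (norm (u y - u z) powr q) \<partial>?B) \<partial>?B)"
    by (intro nn_integral_mono inner)
  finally show ?thesis
    using V \<open>0 < t\<close> by (simp add: V_def[symmetric] ennreal_mult[symmetric] power2_eq_square mult_ac)
qed

section \<open>Continuity of ball averages in the centre\<close>

text \<open>Dominated convergence with majorant \<open>norm (u y - c)\<close> on \<open>K\<close>:
  the indicators of the moving balls converge off the limiting sphere, which is a null set.\<close>

lemma continuous_on_average_ball_norm:
  fixes u :: "'a::euclidean_space \<Rightarrow> 'b::euclidean_space"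
  assumes u: "integrable (lebesgue_on K) u" and K: "compact K"
    and sub: "\<And>x. x \<in> S \<Longrightarrow> ball x \<rho> \<subseteq> K"
  shows "continuous_on S (\<lambda>x. average (ball x \<rho>) (\<lambda>y. norm (u y - c)))"
proof -
  let ?f = "\<lambda>x y. indicator (ball x \<rho>) y * norm (u y - c)"
  have Kleb: "K \<in> sets lebesgue" "emeasure lebesgue K < \<infinity>"
    using \<open>compact K\<close> emeasure_compact_finite by (auto simp: fmeasurableD compact_imp_closed)
  then interpret finite_measure "lebesgue_on K"
    by (intro finite_measureI) (simp add: emeasure_restrict_space space_restrict_space)
  have "integrable (lebesgue_on K) (\<lambda>y. norm (u y - c))"
    using u by simp
  then have w: "integrable lebesgue (\<lambda>y. indicator K y * norm (u y - c))"
    using Kleb by (simp add: integrable_restrict_space)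
  then have wm: "(\<lambda>y. indicator K y * norm (u y - c)) \<in> borel_measurable lebesgue"
    by auto
  have meas: "?f x \<in> borel_measurable lebesgue" if "x \<in> S" for x
  proof -
    \<comment> \<open>\<open>u\<close> is known to be measurable on \<open>K\<close> only, so the
      indicator of \<open>K\<close> is inserted; it changes nothing on the ball.\<close>
    have "(\<lambda>y. indicator (ball x \<rho>) y * (indicator K y * norm (u y - c))) \<in> borel_measurable lebesgue"
      by (rule borel_measurable_times[OF borel_measurable_indicator wm]) simp
    also have "(\<lambda>y. indicator (ball x \<rho>) y * (indicator K y * norm (u y - c))) = ?f x"
      using sub[OF that] by (intro ext) (auto split: split_indicator)
    finally show ?thesis .
  qed
  have "continuous_on S (\<lambda>x. \<integral>y. ?f x y \<partial>lebesgue)"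
    unfolding continuous_on_sequentially
  proof (intro allI ballI impI, elim conjE)
    fix X a assume a: "a \<in> S" and X: "\<forall>n. X n \<in> S" "X \<longlonglongrightarrow> a"
    have "(\<lambda>n. \<integral>y. ?f (X n) y \<partial>lebesgue) \<longlonglongrightarrow> (\<integral>y. ?f a y \<partial>lebesgue)"
    proof (rule integral_dominated_convergence[OF meas[OF a] _ w])
      show "?f (X n) \<in> borel_measurable lebesgue" for n
        using X meas by auto
      show "AE y in lebesgue. norm (?f (X n) y) \<le> indicator K y * norm (u y - c)" for n
      proof (rule AE_I2)
        have "ball (X n) \<rho> \<subseteq> K"
          using X(1) sub by blast
        then show "norm (?f (X n) y) \<le> indicator K y * norm (u y - c)" for y
          by (auto split: split_indicator)
      qed
      have "sphere a \<rho> \<in> null_sets lebesgue"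
        using negligible_sphere negligible_iff_null_sets by blast
      then have "AE y in lebesgue. y \<notin> sphere a \<rho>"
        by (rule AE_not_in)
      then show "AE y in lebesgue. (\<lambda>n. ?f (X n) y) \<longlonglongrightarrow> ?f a y"
      proof (rule AE_mp, intro AE_I2 impI)
        fix y assume "y \<notin> sphere a \<rho>"
        then consider "dist a y < \<rho>" | "\<rho> < dist a y" by force
        then have "\<forall>\<^sub>F n in sequentially. ?f a y = ?f (X n) y"
        proof cases
          case 1
          then have "\<forall>\<^sub>F n in sequentially. dist (X n) y < \<rho>"
            using X(2) by (intro order_tendstoD(2)[OF tendsto_dist]) auto
          then show ?thesis by eventually_elim (use 1 in auto)
        next
          case 2
          then have "\<forall>\<^sub>F n in sequentially. \<rho> < dist (X n) y"
            using X(2) by (intro order_tendstoD(1)[OF tendsto_dist]) auto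
          then show ?thesis by eventually_elim (use 2 in auto)
        qed
        then show "(\<lambda>n. ?f (X n) y) \<longlonglongrightarrow> ?f a y"
          by (rule Lim_transform_eventually[OF tendsto_const])
      qed
    qed
    then show "((\<lambda>x. \<integral>y. ?f x y \<partial>lebesgue) \<circ> X) \<longlonglongrightarrow> (\<integral>y. ?f a y \<partial>lebesgue)"
      by (simp add: o_def)
  qed
  then have "continuous_on S (\<lambda>x. (1 / V) * (\<integral>y. ?f x y \<partial>lebesgue))" for V
    by (rule continuous_on_mult_left)
  \<comment> \<open>The volume of the ball does not depend on its centre; for negative
    \<open>\<rho>\<close> the ball is empty.\<close>
  moreover obtain V where "\<And>x :: 'a. measure lborel (ball x \<rho>) = V"
    by (cases "\<rho> \<ge> 0") (auto simp: content_ball ball_empty)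
  ultimately show ?thesis
    by (simp add: average_def set_lebesgue_integral_def)
qed

section \<open>Compact exhaustion and levels of the lower limit\<close>

text \<open>A compact exhaustion of an open \<open>\<Omega>\<close> as \<open>t\<close> decreases to
  0. The distance to the complement is expressed by a quantifier because \<open>infdist\<close> to
  the empty set is 0, which would spoil the case that \<open>\<Omega>\<close> is the whole
  space.\<close>

definition inner_region :: "'a::euclidean_space set \<Rightarrow> real \<Rightarrow> 'a set" where
  "inner_region \<Omega> t = {x. norm x \<le> 1 / t \<and> (\<forall>z. z \<notin> \<Omega> \<longrightarrow> t \<le> dist x z)}"

lemma compact_inner_region: "compact (inner_region \<Omega> t)"
proof -
  have "inner_region \<Omega> t = {x. norm x \<le> 1 / t} \<inter> (\<Inter>z\<in>-\<Omega>. {x. t \<le> dist x z})"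
    by (auto simp: inner_region_def)
  moreover have "closed ({x. norm x \<le> 1 / t} \<inter> (\<Inter>z\<in>-\<Omega>. {x. t \<le> dist x z}))"
    by (intro closed_Int closed_INT closed_Collect_le ballI continuous_intros)
  moreover have "bounded (inner_region \<Omega> t)"
    unfolding bounded_iff by (auto simp: inner_region_def)
  ultimately show ?thesis
    by (simp add: compact_eq_bounded_closed)
qed

lemma inner_region_subset: "0 < t \<Longrightarrow> inner_region \<Omega> t \<subseteq> \<Omega>"
  by (force simp: inner_region_def)

lemma ball_subset_inner_region:
  assumes "x \<in> inner_region \<Omega> t" "0 < t" "t \<le> 1"
  shows "ball x (t / 2) \<subseteq> inner_region \<Omega> (t / 2)"
proof
  fix y assume "y \<in> ball x (t / 2)"
  then have y: "dist x y < t / 2" by simp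
  \<comment> \<open>As \<open>t\<close> is at most 1, a shift by less than \<open>t / 2\<close> is a
    shift by at most \<open>1 / t\<close>, so the norm stays below \<open>2 / t\<close>.\<close>
  have "1 \<le> 1 / t"
    using assms by simp
  then have "dist x y \<le> 1 / t"
    using y assms(3) by linarith
  moreover have "norm x \<le> 1 / t"
    using assms(1) by (simp add: inner_region_def)
  moreover have "norm y \<le> norm x + dist x y"
    by (metis add.commute dist_norm dist_commute norm_triangle_sub)
  ultimately have "norm y \<le> 1 / (t / 2)" by simp
  moreover have "t / 2 \<le> dist y z" if "z \<notin> \<Omega>" for z
    using assms(1) that y dist_triangle[of x z y] by (force simp: inner_region_def)
  ultimately show "y \<in> inner_region \<Omega> (t / 2)"
    by (simp add: inner_region_def)
qed

text \<open>The single parameter \<open>t\<close> controls location, height and range of radii.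
  Radii below \<open>t / 2\<close> keep the balls inside
  \<open>inner_region \<Omega> (t / 2)\<close> when \<open>t\<close> is at most 1.\<close>

definition liminf_level :: "'a::euclidean_space set \<Rightarrow> ('a \<Rightarrow> real \<Rightarrow> ereal) \<Rightarrow> real \<Rightarrow> 'a set" where
  "liminf_level \<Omega> h t = {x \<in> inner_region \<Omega> t. \<forall>\<rho>\<in>{0<..<t / 2}. ereal t \<le> h x \<rho>}"

text \<open>A positive lower limit gives a positive lower bound for all small radii, and one
  sufficiently small \<open>1 / real (Suc n)\<close> meets all conditions of a level at
  once.\<close>

lemma Liminf_nonzero_eq_Union_level:
  assumes "open \<Omega>" and nonneg: "\<And>x \<rho>. 0 \<le> h x \<rho>"
  shows "{x \<in> \<Omega>. \<not> Liminf (at_right 0) (h x) = 0} = (\<Union>n. liminf_level \<Omega> h (1 / real (Suc n)))"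
proof (intro equalityI subsetI)
  fix x assume "x \<in> {x \<in> \<Omega>. \<not> Liminf (at_right 0) (h x) = 0}"
  then have x: "x \<in> \<Omega>" and "Liminf (at_right 0) (h x) \<noteq> 0" by auto
  moreover have "0 \<le> Liminf (at_right 0) (h x)"
    by (intro Liminf_bounded) (simp add: nonneg)
  ultimately have "0 < Liminf (at_right 0) (h x)" by simp
  then obtain y where y: "0 < ereal y" "ereal y < Liminf (at_right 0) (h x)"
    using ereal_dense2 by blast
  have "\<forall>\<^sub>F \<rho> in at_right 0. ereal y < h x \<rho>"
    using y(2) le_Liminf_iff[of "Liminf (at_right 0) (h x)" "at_right 0" "h x"] by blast
  then obtain b where b: "b > 0" "\<And>\<rho>. 0 < \<rho> \<Longrightarrow> \<rho> < b \<Longrightarrow> ereal y < h x \<rho>"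
    by (auto simp: eventually_at_right_field)
  obtain e where e: "e > 0" "ball x e \<subseteq> \<Omega>"
    using \<open>open \<Omega>\<close> x openE by blast
  \<comment> \<open>In turn: the range of radii, the height, the distance to the complement, and the
    bound on the norm of \<open>x\<close>.\<close>
  define s where "s = min (min b y) (min e (1 / (norm x + 1)))"
  have "s > 0" using b e y by (simp add: s_def add_nonneg_pos)
  then obtain n where n: "1 / real (Suc n) < s"
    using nat_approx_posE by blast
  define t where "t = 1 / real (Suc n)"
  have t: "0 < t" "t < b" "t < y" "t < e" "t < 1 / (norm x + 1)"
    using n by (auto simp: t_def s_def)
  have "norm x \<le> 1 / t"
  proof -
    have "t * (norm x + 1) < 1"
      using t(5) by (simp add: pos_less_divide_eq add_nonneg_pos)
    then have "norm x * t \<le> 1"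
      using t(1) by (simp add: algebra_simps)
    then show ?thesis
      using t(1) by (simp add: pos_le_divide_eq)
  qed
  moreover have "t \<le> dist x z" if "z \<notin> \<Omega>" for z
    using that e t by (force simp: subset_iff)
  moreover have "ereal t \<le> h x \<rho>" if "\<rho> \<in> {0<..<t / 2}" for \<rho>
  proof -
    have "ereal t \<le> ereal y" using t by simp
    also have "\<dots> \<le> h x \<rho>" using b(2)[of \<rho>] that t by (intro less_imp_le) auto
    finally show ?thesis .
  qed
  ultimately have "x \<in> liminf_level \<Omega> h t"
    by (simp add: liminf_level_def inner_region_def)
  then show "x \<in> (\<Union>n. liminf_level \<Omega> h (1 / real (Suc n)))"
    unfolding t_def by blast
next
  fix x assume "x \<in> (\<Union>n. liminf_level \<Omega> h (1 / real (Suc n)))"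
  then obtain n where "x \<in> liminf_level \<Omega> h (1 / real (Suc n))"
    by blast
  moreover define t where "t = 1 / real (Suc n)"
  ultimately have t: "t > 0" and n: "x \<in> liminf_level \<Omega> h t"
    by auto
  have x: "x \<in> inner_region \<Omega> t" "\<And>\<rho>. \<rho> \<in> {0<..<t / 2} \<Longrightarrow> ereal t \<le> h x \<rho>"
    using n by (auto simp: liminf_level_def)
  have "\<forall>\<^sub>F \<rho> in at_right 0. ereal t \<le> h x \<rho>"
    using t x(2) by (auto simp: eventually_at_right_field intro!: exI[of _ "t / 2"])
  then have "ereal t \<le> Liminf (at_right 0) (h x)"
    by (rule Liminf_bounded)
  then have "Liminf (at_right 0) (h x) \<noteq> 0"
    using t by auto
  then show "x \<in> {x \<in> \<Omega>. \<not> Liminf (at_right 0) (h x) = 0}"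
    using inner_region_subset[OF t] x(1) by auto
qed

section \<open>Measure and closedness of the levels\<close>

text \<open>A level stays away from the complement of \<open>\<Omega>\<close>, so the local
  hypothesis on \<open>u\<close> yields a global one near it. The quantity \<open>h\<close> is left
  abstract to cover both the deviation from the mean and the oscillation.\<close>

lemma BVq_loc_hausdorff_closure_level:
  fixes u :: "'a::euclidean_space \<Rightarrow> 'b::euclidean_space"
  assumes u: "u \<in> BVq_loc q \<Omega>" and q: "1 \<le> q" and t: "0 < t" "t \<le> 1"
    and "0 < c" and lower: "\<And>x \<rho>. \<lbrakk>0 < \<rho>; integrable (lebesgue_on (ball x \<rho>)) u; ereal t \<le> h x \<rho>\<rbrakk> \<Longrightarrow>
      ennreal (c * (measure lborel (ball x \<rho>))\<^sup>2) \<le>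
        (\<integral>\<^sup>+y. (\<integral>\<^sup>+z. ennreal (norm (u y - u z) powr q)
            \<partial>lebesgue_on (ball x \<rho>)) \<partial>lebesgue_on (ball x \<rho>))"
  shows "hausdorff_measure (real DIM('a) - 1) (closure (liminf_level \<Omega> h t)) < \<infinity>"
proof -
  define K where "K = inner_region \<Omega> (t / 2)"
  have K: "compact K" "K \<subseteq> \<Omega>"
    using t by (auto simp: K_def compact_inner_region inner_region_subset[of "t / 2" \<Omega>, THEN subsetD])
  have uK: "u \<in> Lq q K"
    using u K by (auto simp: BVq_loc_def Lq_loc_def)
  \<comment> \<open>An open set that contains all balls of radius \<open>t / 2\<close> around the
    level and whose closure lies in the compact set \<open>K\<close>.\<close>
  define U where "U = (\<Union>x\<in>inner_region \<Omega> t. ball x (t / 2))"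
  have UK: "U \<subseteq> K"
    unfolding U_def K_def using ball_subset_inner_region t by blast
  then have cl: "closure U \<subseteq> K"
    using K by (simp add: closure_minimal compact_imp_closed)
  then have "compact (closure U)"
    using K(1) by (metis closed_closure compact_Int_closed inf.absorb_iff2)
  moreover have "closure U \<subseteq> \<Omega>" "open U"
    using cl K(2) by (auto simp: U_def)
  ultimately have uU: "u \<in> BVq q U"
    using u unfolding BVq_loc_def by blast
  show ?thesis
  proof (rule BVq_hausdorff_measure_closure_less_top[OF uU _ _ \<open>c > 0\<close>])
    show "open U" by (auto simp: U_def)
    show "0 < t / 2" using t by simp
    show "ball x (t / 2) \<subseteq> U" if "x \<in> liminf_level \<Omega> h t" for x
      using that by (auto simp: U_def liminf_level_def)
    fix x \<rho> assume x: "x \<in> liminf_level \<Omega> h t" and \<rho>: "0 < \<rho>" "\<rho> < t / 2"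
    then have "ball x \<rho> \<subseteq> K"
      using UK subset_ball[of \<rho> "t / 2" x] by (fastforce simp: U_def liminf_level_def)
    then show "ennreal (c * (measure lborel (ball x \<rho>))\<^sup>2) \<le>
        (\<integral>\<^sup>+y. (\<integral>\<^sup>+z. ennreal (norm (u y - u z) powr q)
            \<partial>lebesgue_on (ball x \<rho>)) \<partial>lebesgue_on (ball x \<rho>))"
      using x \<rho> q K uK by (intro lower Lq_integrable_ball) (auto simp: liminf_level_def)
  qed
qed

text \<open>An infimum is at least \<open>t\<close> exactly when every member is, so the level is an
  intersection of closed superlevel sets of continuous averages. This makes
  \<open>singular_set\<close> an F-sigma set.\<close>

lemma closed_level_oscillation:
  fixes u :: "'a::euclidean_space \<Rightarrow> 'b::euclidean_space"
  assumes u: "u \<in> Lq_loc q \<Omega>" and q: "1 \<le> q" and t: "0 < t" "t \<le> 1"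
  shows "closed (liminf_level \<Omega> (\<lambda>x \<rho>. INF c. ereal (average (ball x \<rho>) (\<lambda>y. norm (u y - c)))) t)"
proof -
  let ?G = "inner_region \<Omega> t" and ?K = "inner_region \<Omega> (t / 2)"
  let ?C = "\<lambda>\<rho> c. {x \<in> ?G. t \<le> average (ball x \<rho>) (\<lambda>y. norm (u y - c))}"
  have uK: "u \<in> Lq q ?K"
    using u t compact_inner_region inner_region_subset[of "t / 2" \<Omega>] by (auto simp: Lq_loc_def)
  have eq: "liminf_level \<Omega> (\<lambda>x \<rho>. INF c. ereal (average (ball x \<rho>) (\<lambda>y. norm (u y - c)))) t
      = ?G \<inter> (\<Inter>\<rho>\<in>{0<..<t / 2}. \<Inter>c. ?C \<rho> c)"
    by (auto simp: liminf_level_def le_INF_iff)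
  have "closed (?C \<rho> c)" if \<rho>: "\<rho> \<in> {0<..<t / 2}" for \<rho> c
  proof -
    have "ball x \<rho> \<subseteq> ?K" if "x \<in> ?G" for x
      using ball_subset_inner_region[OF that t] \<rho> subset_ball[of \<rho> "t / 2" x] by auto
    then have "continuous_on ?G (\<lambda>x. average (ball x \<rho>) (\<lambda>y. norm (u y - c)))"
      using Lq_integrable[OF uK q compact_inner_region]
      by (intro continuous_on_average_ball_norm[OF _ compact_inner_region]) auto
    then show ?thesis
      using compact_inner_region[of \<Omega> t]
      by (intro continuous_on_closed_Collect_le) (auto intro: compact_imp_closed)
  qed
  then show ?thesis
    unfolding eq using compact_inner_region[of \<Omega> t]
    by (intro closed_Int closed_INT ballI) (auto intro: compact_imp_closed)
qed

section \<open>Assembly of the two exceptional sets\<close>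

theorem theorem1p5:
  fixes \<Omega> :: "(real ^ 'N) set" and u :: "real ^ 'N \<Rightarrow> real ^ 'd" and q :: real
  assumes "open \<Omega>" and "1 \<le> q" and "u \<in> BVq_loc q \<Omega>"
  shows "(\<exists>S. S \<in> sets borel \<and> hausdorff_sigma_finite (real CARD('N) - 1) S \<and>
            hausdorff_measure (real CARD('N) - 1)
              {x \<in> \<Omega> - S. \<not> Liminf (at_right 0)
                 (\<lambda>\<epsilon>. ereal (average (ball x \<epsilon>)
                    (\<lambda>z. norm (u z - average (ball x \<epsilon>) u) powr q))) = 0} = 0) \<and>
         singular_set \<Omega> u \<in> sets borel \<and>
         hausdorff_sigma_finite (real CARD('N) - 1) (singular_set \<Omega> u)"
proof -
  let ?s = "real CARD('N) - 1"
  let ?h = "\<lambda>x \<epsilon>. ereal (average (ball x \<epsilon>) (\<lambda>z. norm (u z - average (ball x \<epsilon>) u) powr q))"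
  let ?g = "\<lambda>x \<rho>. INF c. ereal (average (ball x \<rho>) (\<lambda>y. norm (u y - c)))"
  let ?t = "\<lambda>n. 1 / real (Suc n)"
  let ?L = "\<lambda>n. liminf_level \<Omega> ?h (?t n)" and ?L' = "\<lambda>n. liminf_level \<Omega> ?g (?t n)"
  \<comment> \<open>Closures make \<open>S\<close> a Borel set without any regularity of the levels,
    and their measure is still finite. As \<open>S\<close> contains all the levels, the set of
    exceptions outside \<open>S\<close> is empty.\<close>
  define S where "S = (\<Union>n. closure (?L n))"
  have "{x \<in> \<Omega>. \<not> Liminf (at_right 0) (?h x) = 0} = (\<Union>n. ?L n)"
    by (intro Liminf_nonzero_eq_Union_level assms) (simp add: average_ball_nonneg)
  also have "\<dots> \<subseteq> S"
    unfolding S_def using closure_subset by blast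
  finally have "{x \<in> \<Omega> - S. \<not> Liminf (at_right 0) (?h x) = 0} = {}"
    by blast
  moreover have "hausdorff_measure ?s ({} :: (real ^ 'N) set) = 0"
    by (rule hausdorff_measure_empty)
  ultimately have null: "hausdorff_measure ?s {x \<in> \<Omega> - S. \<not> Liminf (at_right 0) (?h x) = 0} = 0"
    by metis
  have "hausdorff_measure ?s (closure (?L n)) < \<infinity>" for n
  proof -
    have "hausdorff_measure (real DIM(real ^ 'N) - 1) (closure (?L n)) < \<infinity>"
      using assms
      by (intro BVq_loc_hausdorff_closure_level[where c = "?t n"] double_integral_ge_of_average_deviation_ge) auto
    then show ?thesis by simp
  qed
  then have S: "S \<in> sets borel" "hausdorff_sigma_finite ?s S"
    by (auto simp: S_def hausdorff_sigma_finite_def)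
  have sing: "singular_set \<Omega> u = (\<Union>n. ?L' n)"
    unfolding singular_set_def
    by (intro Liminf_nonzero_eq_Union_level assms) (auto intro!: INF_greatest average_ball_nonneg)
  have closed: "closed (?L' n)" for n
    using assms by (intro closed_level_oscillation) (auto simp: BVq_loc_def)
  have "hausdorff_measure ?s (?L' n) < \<infinity>" for n
  proof -
    have "hausdorff_measure (real DIM(real ^ 'N) - 1) (closure (?L' n)) < \<infinity>"
    \<comment> \<open>The oscillation involves the first power of the norm, so the level height
      enters the energy bound as its power of order \<open>q\<close>; for \<open>?h\<close> above it
      was the height itself.\<close>
    proof (rule BVq_loc_hausdorff_closure_level[OF assms(3,2), where c = "?t n powr q"])
      fix x :: "real ^ 'N" and \<rho> :: real
      assume "integrable (lebesgue_on (ball x \<rho>)) u" "ereal (?t n) \<le> ?g x \<rho>"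
      then show "ennreal (?t n powr q * (measure lborel (ball x \<rho>))\<^sup>2) \<le>
        (\<integral>\<^sup>+y. (\<integral>\<^sup>+z. ennreal (norm (u y - u z) powr q)
            \<partial>lebesgue_on (ball x \<rho>)) \<partial>lebesgue_on (ball x \<rho>))"
        using assms(2)
        by (intro double_integral_ge_of_average_norm_ge) (auto simp: le_INF_iff simp del: of_nat_Suc)
    qed auto
    \<comment> \<open>The level equals its closure, so \<open>singular_set\<close> itself inherits
      the bound.\<close>
    then show ?thesis using closed by simp
  qed
  then have "hausdorff_sigma_finite ?s (singular_set \<Omega> u)"
    unfolding sing hausdorff_sigma_finite_def by blast
  moreover have "singular_set \<Omega> u \<in> sets borel"
    unfolding sing using closed by auto
  ultimately show ?thesis
    using S null by (intro conjI exI[of _ S])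
qed

end
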